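(* Fix integers $d,N,m\ge1$. Let $V_1,\dots,V_d:\mathbb{R}^N\to\mathbb{R}^N$ be smooth vector fields, and suppose that the tree-like vector fields $$\{V_\tau:\mathbb{R}^N\to\mathbb{R}^N ~|~ \tau\in\mathbb{T}_w,\ w\in\mathscr{W}_m\}$$ are linearly independent. Then the operators $$\{V_w:C^\infty(\mathbb{R}^N)\to C^\infty(\mathbb{R}^N) ~|~ w\in\mathscr{W}_m\}$$ (a family indexed by the words $w\in\mathscr{W}_m$) are linearly independent.
   Context: $\mathscr{W}_m$ is the set of words $w=(w_1,\dots,w_m)$ with letters $w_l\in\{1,\dots,d\}$. $C^\infty(\mathbb{R}^N)$ is the space of smooth functions $\mathbb{R}^N\to\mathbb{R}$. Linear independence is over $\mathbb{R}$. Iterated operators. For a letter $i$, a nonempty word $w$, $\phi\in C^\infty(\mathbb{R}^N)$ and $x\in\mathbb{R}^N$: $V_i\phi(x)=(\nabla\phi(x))^TV_i(x)$ and $V_{wi}\phi(x)=V_i(V_w\phi)(x)=(\nabla(V_w\phi)(x))^TV_i(x)$, where $wi$ is the word $w$ followed by the letter $i$. Trees. For $w\in\mathscr{W}_m$, $\mathbb{T}_w$ is the set of letter-labelled recursive trees of order $m$ with letter labels $w$: rooted trees on the vertex set $\{1,\dots,m\}$ with root $1$, in which each vertex $l\ge2$ is attached by an edge to a parent vertex in $\{1,\dots,l-1\}$, and vertex $l$ carries the letter $w_l$. The order of the branches at a vertex is ignored. $\bullet_i$ is the one-vertex tree with letter $i$, and $[\tau_1\cdots\tau_k]_{\bullet_i}$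 is the tree obtained by attaching the roots of $\tau_1,\dots,\tau_k$ to a new root with letter $i$. Tree-like vector fields. To each tree $\tau$ associate $V_\tau:\mathbb{R}^N\to\mathbb{R}^N$ recursively by $V_{\bullet_i}(x)=V_i(x)$ and $$V_{[\tau_1\cdots\tau_k]_{\bullet_i}}(x)=\sum_{j_1,\dots,j_k=1}^N\frac{\partial^kV_i}{\partial x_{j_k}\cdots\partial x_{j_1}}(x)\cdot\pi_{j_1}(V_{\tau_1}(x))\cdots\pi_{j_k}(V_{\tau_k}(x)),$$ where $\pi_j:\mathbb{R}^N\to\mathbb{R}$ is the $j$-th coordinate projection. $V_\tau$ depends only on the underlying rooted tree with its letters, not on the numbering of the vertices. Linear independence of $\{V_\tau ~|~ \tau\in\mathbb{T}_w,\ w\in\mathscr{W}_m\}$ means linear independence of the family indexed by these trees, where trees (possibly belonging to different words) that are isomorphic as letter-labelled rooted trees (forgetting the numbering) are identified and counted once. *)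

theory Defs
  imports "HOL-Analysis.Analysis" "HOL-Library.Multiset"
begin

section \<open>Smooth functions\<close>

definition partial :: "'n \<Rightarrow> (real ^ 'n \<Rightarrow> 'b) \<Rightarrow> real ^ 'n \<Rightarrow> 'b::real_normed_vector"
  where "partial j f x = frechet_derivative f (at x) (axis j 1)"

primrec C_k :: "nat \<Rightarrow> (real ^ 'n \<Rightarrow> 'b::real_normed_vector) \<Rightarrow> bool" where
  "C_k 0 f \<longleftrightarrow> continuous_on UNIV f"
| "C_k (Suc k) f \<longleftrightarrow> f differentiable_on UNIV \<and> (\<forall>j. C_k k (partial j f))"

definition smooth :: "(real ^ 'n \<Rightarrow> 'b::real_normed_vector) \<Rightarrow> bool"
  where "smooth f \<longleftrightarrow> (\<forall>k. C_k k f)"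

definition grad :: "(real ^ 'n \<Rightarrow> real) \<Rightarrow> real ^ 'n \<Rightarrow> real ^ 'n"
  where "grad \<phi> x = (\<chi> j. partial j \<phi> x)"

text \<open>The differentiation with respect to the head of the list is carried out first, so
  \<open>iter_partial [j\<^sub>1, \<dots>, j\<^sub>k] f\<close> is the k-th derivative of f by
  \<open>x\<^bsub>j\<^sub>k\<^esub> \<dots> x\<^bsub>j\<^sub>1\<^esub>\<close>.\<close>

definition iter_partial ::
    "'n list \<Rightarrow> (real ^ 'n \<Rightarrow> 'b) \<Rightarrow> real ^ 'n \<Rightarrow> 'b::real_normed_vector"
  where "iter_partial js f = fold partial js f"


section \<open>Words and iterated operators\<close>

definition words :: "nat \<Rightarrow> nat \<Rightarrow> nat list set"
  where "words d m = {w. length w = m \<and> set w \<subseteq> {1..d}}"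

definition letter_op ::
    "(nat \<Rightarrow> real ^ 'n \<Rightarrow> real ^ 'n) \<Rightarrow> nat \<Rightarrow> (real ^ 'n \<Rightarrow> real) \<Rightarrow> real ^ 'n \<Rightarrow> real"
  where "letter_op V i \<phi> x = grad \<phi> x \<bullet> V i x"

text \<open>The first letter of the word acts first. The empty word gives the identity.\<close>

definition word_op ::
    "(nat \<Rightarrow> real ^ 'n \<Rightarrow> real ^ 'n) \<Rightarrow> nat list \<Rightarrow> (real ^ 'n \<Rightarrow> real) \<Rightarrow> real ^ 'n \<Rightarrow> real"
  where "word_op V w \<phi> = fold (letter_op V) w \<phi>"

lemma word_op_single: "word_op V [i] \<phi> = letter_op V i \<phi>"
  by (simp add: word_op_def)

lemma word_op_snoc: "word_op V (w @ [i]) \<phi> = letter_op V i (word_op V w \<phi>)"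
  by (simp add: word_op_def)


section \<open>Trees\<close>

text \<open>Letter-labelled rooted trees without numbering. Since the branches form a multiset,
  isomorphic trees are equal.\<close>

datatype ltree = Node nat "ltree multiset"

text \<open>A recursive tree on the vertices \<open>{1..m}\<close> with root 1 is given by its parent function;
  together with a word w of length m it is a letter-labelled recursive tree.\<close>

definition recursive_trees :: "nat \<Rightarrow> (nat \<Rightarrow> nat) set"
  where "recursive_trees m = (\<Pi>\<^sub>E l\<in>{2..m}. {1..<l})"

text \<open>The subtree with root v of the recursive tree with parent function p and letters w,
  forgetting the numbering. Vertex l carries the letter \<open>w ! (l - 1)\<close>. The bound \<open>v < l\<close> always
  holds for children l of v in a recursive tree; it makes the recursion terminate for all p.\<close>

lemma image_mset_fundef_cong [fundef_cong]:
  "M = N \<Longrightarrow> (\<And>x. x \<in># N \<Longrightarrow> f x = g x) \<Longrightarrow> image_mset f M = image_mset g N"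
  using image_mset_cong by blast

function subtree :: "nat list \<Rightarrow> (nat \<Rightarrow> nat) \<Rightarrow> nat \<Rightarrow> ltree" where
  "subtree w p v =
     Node (w ! (v - 1)) (image_mset (subtree w p) (mset_set {l \<in> {v<..length w}. p l = v}))"
  by pat_completeness auto
termination
  by (relation "Wellfounded.measure (\<lambda>(w, p, v). Suc (length w) - v)") auto

declare subtree.simps [simp del]

definition unnumbered :: "nat list \<Rightarrow> (nat \<Rightarrow> nat) \<Rightarrow> ltree"
  where "unnumbered w p = subtree w p 1"

definition trees :: "nat \<Rightarrow> nat \<Rightarrow> ltree set"
  where "trees d m = {unnumbered w p | w p. w \<in> words d m \<and> p \<in> recursive_trees m}"


section \<open>Tree-like vector fields\<close>

text \<open>The vector field of a tree whose root carries the field f and whose branches have the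
  fields in the multiset G. The branches are enumerated as \<open>\<tau>\<^sub>1, \<dots>, \<tau>\<^sub>k\<close> in an arbitrary order;
  for smooth f the order does not matter because mixed partial derivatives commute.\<close>

definition graft ::
    "(real ^ 'n \<Rightarrow> real ^ 'n) \<Rightarrow> (real ^ 'n \<Rightarrow> real ^ 'n) multiset \<Rightarrow> real ^ 'n \<Rightarrow> real ^ 'n"
  where "graft f G x =
    (let gs = (SOME gs. mset gs = G); k = length gs in
      \<Sum>js | length js = k. (\<Prod>l<k. (gs ! l) x $ (js ! l)) *\<^sub>R iter_partial js f x)"

primrec tree_field :: "(nat \<Rightarrow> real ^ 'n \<Rightarrow> real ^ 'n) \<Rightarrow> ltree \<Rightarrow> real ^ 'n \<Rightarrow> real ^ 'n" where
  "tree_field V (Node i M) = graft (V i) (image_mset (tree_field V) M)"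

lemma tree_field_bullet: "tree_field V (Node i {#}) = V i"
  by (rule ext) (simp add: graft_def iter_partial_def)


section \<open>Linear independence of families of functions\<close>

text \<open>The members of the family \<open>(f i)\<^bsub>i \<in> I\<^esub>\<close> are regarded as functions on D.\<close>

definition lin_indep_family :: "'a set \<Rightarrow> 'i set \<Rightarrow> ('i \<Rightarrow> 'a \<Rightarrow> 'b::real_vector) \<Rightarrow> bool"
  where "lin_indep_family D I f \<longleftrightarrow>
    (\<forall>J c. finite J \<and> J \<subseteq> I \<and> (\<forall>x\<in>D. (\<Sum>i\<in>J. c i *\<^sub>R f i x) = 0) \<longrightarrow> (\<forall>i\<in>J. c i = (0::real)))"

definition fields_lin_indep :: "(nat \<Rightarrow> real ^ 'n \<Rightarrow> real ^ 'n) \<Rightarrow> ltree set \<Rightarrow> bool"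
  where "fields_lin_indep V T \<longleftrightarrow> lin_indep_family UNIV T (tree_field V)"

text \<open>An operator on the smooth functions vanishes iff its value at every smooth \<open>\<phi>\<close> and every
  point x is 0, so it is regarded as a real function of the pair \<open>(\<phi>, x)\<close>.\<close>

definition operators_lin_indep :: "(nat \<Rightarrow> real ^ 'n \<Rightarrow> real ^ 'n) \<Rightarrow> nat list set \<Rightarrow> bool"
  where "operators_lin_indep V W \<longleftrightarrow>
    lin_indep_family (Collect smooth \<times> UNIV) W (\<lambda>w (\<phi>, x). word_op V w \<phi> x)"

end

theory Submission
  imports Defs
begin

text \<open>Applying the operator of a word w to a coordinate function \<open>x\<^sub>j\<close> gives the j-th
  coordinate of the sum of the tree-like vector fields over all recursive trees with letters w:
  by the product rule, differentiating a tree-like field in the direction \<open>V\<^sub>i\<close> attaches a new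
  leaf with letter i to each vertex in turn. Hence a linear relation between the operators is a
  linear relation between tree-like fields. The ladder with letters w from the root to the
  leaf has only one recursive numbering and therefore occurs for the word w alone, exactly once.
  So its coefficient in the relation, which must vanish, is the coefficient of w.\<close>

section \<open>Symmetry of mixed partial derivatives\<close>

lemma has_real_derivative_axis:
  assumes "(f :: real ^ 'n \<Rightarrow> real) differentiable (at (a + t *\<^sub>R axis j 1))"
  shows "((\<lambda>t. f (a + t *\<^sub>R axis j 1)) has_real_derivative partial j f (a + t *\<^sub>R axis j 1)) (at t)"
proof -
  have f: "(f has_derivative frechet_derivative f (at (a + t *\<^sub>R axis j 1))) (at (a + t *\<^sub>R axis j 1))"
    using assms by (simp add: frechet_derivative_works)
  have "((\<lambda>t. a + t *\<^sub>R axis j 1) has_derivative (\<lambda>h. h *\<^sub>R axis j 1)) (at t)"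
    by (auto intro!: derivative_eq_intros)
  from has_derivative_compose[OF this f]
  have "((\<lambda>t. f (a + t *\<^sub>R axis j 1)) has_derivative
      (\<lambda>h. h * partial j f (a + t *\<^sub>R axis j 1))) (at t)"
    by (simp add: partial_def linear_scale[OF linear_frechet_derivative[OF assms]])
  then show ?thesis
    by (rule has_derivative_imp_has_field_derivative) simp
qed

lemma mean_value_axis:
  fixes f :: "real ^ 'n \<Rightarrow> real"
  assumes "\<And>y. f differentiable (at y)" "0 < h"
  obtains t where "0 < t" "t < h"
    "f (a + h *\<^sub>R axis j 1) - f a = h * partial j f (a + t *\<^sub>R axis j 1)"
proof -
  have "\<exists>t>0. t < h \<and> f (a + h *\<^sub>R axis j 1) - f (a + 0 *\<^sub>R axis j 1)
      = (h - 0) * partial j f (a + t *\<^sub>R axis j 1)"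
    by (rule MVT2[OF assms(2), of "\<lambda>t. f (a + t *\<^sub>R axis j 1)"])
      (rule has_real_derivative_axis[OF assms(1)])
  then show ?thesis using that by auto
qed

lemma frechet_derivative_diff_translate:
  fixes g :: "real ^ 'n \<Rightarrow> real"
  assumes "\<And>y. g differentiable (at y)"
  shows "(\<lambda>y. g (y + b) - g y) differentiable (at y)"
    and "partial j (\<lambda>y. g (y + b) - g y) y = partial j g (y + b) - partial j g y"
proof -
  have g: "(g has_derivative frechet_derivative g (at y)) (at y)" for y
    using assms by (simp add: frechet_derivative_works)
  have "((\<lambda>y. y + b) has_derivative (\<lambda>h. h)) (at y)"
    by (auto intro!: derivative_eq_intros)
  from has_derivative_diff[OF has_derivative_compose[OF this g] g]
  have *: "((\<lambda>y. g (y + b) - g y) has_derivative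
    (\<lambda>h. frechet_derivative g (at (y + b)) h - frechet_derivative g (at y) h)) (at y)" .
  then show "(\<lambda>y. g (y + b) - g y) differentiable (at y)"
    by (auto simp: differentiable_def)
  show "partial j (\<lambda>y. g (y + b) - g y) y = partial j g (y + b) - partial j g y"
    by (simp add: partial_def frechet_derivative_at[OF *, symmetric])
qed

text \<open>The second difference is the increment in direction \<open>j\<close> of the first
  difference in direction \<open>k\<close>. The mean value theorem is applied to that increment and
  then, in direction \<open>k\<close>, to \<open>partial j g\<close>.\<close>

lemma second_difference_mean_value:
  fixes g :: "real ^ 'n \<Rightarrow> real"
  assumes "\<And>y. g differentiable (at y)" "\<And>y. partial j g differentiable (at y)" "0 < h"
  obtains z where "dist z x < 2 * h"
    "g (x + h *\<^sub>R axis j 1 + h *\<^sub>R axis k 1) - g (x + h *\<^sub>R axis j 1)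
      - g (x + h *\<^sub>R axis k 1) + g x = h * (h * partial k (partial j g) z)"
proof -
  let ?b = "h *\<^sub>R axis k (1::real)"
  have d: "(\<lambda>y. g (y + ?b) - g y) differentiable (at y)"
    and p: "partial j (\<lambda>y. g (y + ?b) - g y) y = partial j g (y + ?b) - partial j g y" for y
    using frechet_derivative_diff_translate[OF assms(1)] by auto
  obtain s where s: "0 < s" "s < h" and
    1: "(g (x + h *\<^sub>R axis j 1 + ?b) - g (x + h *\<^sub>R axis j 1)) - (g (x + ?b) - g x)
      = h * (partial j g (x + s *\<^sub>R axis j 1 + ?b) - partial j g (x + s *\<^sub>R axis j 1))"
    by (rule mean_value_axis[OF d assms(3), of x j]) (simp add: p)
  obtain t where t: "0 < t" "t < h" and
    2: "partial j g (x + s *\<^sub>R axis j 1 + ?b) - partial j g (x + s *\<^sub>R axis j 1)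
      = h * partial k (partial j g) (x + s *\<^sub>R axis j 1 + t *\<^sub>R axis k 1)"
    by (rule mean_value_axis[OF assms(2,3)])
  have "dist (x + s *\<^sub>R axis j 1 + t *\<^sub>R axis k 1) x = norm (s *\<^sub>R axis j (1::real) + t *\<^sub>R axis k 1 :: real ^ 'n)"
    by (simp add: dist_norm algebra_simps)
  also have "\<dots> \<le> s + t"
    using norm_triangle_ineq[of "s *\<^sub>R axis j (1::real) :: real ^ 'n" "t *\<^sub>R axis k 1"] s t
    by (simp add: norm_axis_1)
  finally show ?thesis
    using s t 1 2 by (intro that[of "x + s *\<^sub>R axis j 1 + t *\<^sub>R axis k 1"]) (auto simp: algebra_simps)
qed

lemma partial_commute_real:
  fixes g :: "real ^ 'n \<Rightarrow> real"
  assumes "C_k 2 g"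
  shows "partial k (partial j g) x = partial j (partial k g) x"
proof -
  have d: "g differentiable (at y)" "partial i g differentiable (at y)" for i y
    using assms by (auto simp: numeral_2_eq_2 differentiable_on_def)
  have c: "isCont (partial i' (partial i g)) x" for i i'
    using assms by (auto simp: numeral_2_eq_2 continuous_on_eq_continuous_at)
  let ?A = "partial k (partial j g)" and ?B = "partial j (partial k g)"
  have "\<bar>?A x - ?B x\<bar> \<le> e" if "e > 0" for e
  proof -
    obtain \<delta>1 where \<delta>1: "\<delta>1 > 0" "\<And>y. dist y x < \<delta>1 \<Longrightarrow> dist (?A y) (?A x) < e / 2"
      using c[of k j] \<open>e > 0\<close> unfolding continuous_at_eps_delta by (meson half_gt_zero)
    obtain \<delta>2 where \<delta>2: "\<delta>2 > 0" "\<And>y. dist y x < \<delta>2 \<Longrightarrow> dist (?B y) (?B x) < e / 2"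
      using c[of j k] \<open>e > 0\<close> unfolding continuous_at_eps_delta by (meson half_gt_zero)
    \<comment> \<open>The intermediate points are only known to lie within \<open>2 * h\<close> of
      \<open>x\<close>, hence the factor one half.\<close>
    define h where "h = min \<delta>1 \<delta>2 / 2"
    have h: "h > 0" "2 * h \<le> \<delta>1" "2 * h \<le> \<delta>2" using \<delta>1 \<delta>2 by (auto simp: h_def)
    obtain z where z: "dist z x < 2 * h"
      "g (x + h *\<^sub>R axis j 1 + h *\<^sub>R axis k 1) - g (x + h *\<^sub>R axis j 1)
      - g (x + h *\<^sub>R axis k 1) + g x = h * (h * ?A z)"
      by (rule second_difference_mean_value[OF d h(1)])
    obtain z' where z': "dist z' x < 2 * h"
      "g (x + h *\<^sub>R axis k 1 + h *\<^sub>R axis j 1) - g (x + h *\<^sub>R axis k 1)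
      - g (x + h *\<^sub>R axis j 1) + g x = h * (h * ?B z')"
      by (rule second_difference_mean_value[OF d h(1)])
    \<comment> \<open>The second difference is symmetric in \<open>j\<close> and \<open>k\<close>,
      so both orders of differentiation agree, although at different points near \<open>x\<close>.
      Continuity then carries this over to \<open>x\<close>.\<close>
    have "h * (h * ?A z) = h * (h * ?B z')"
      using z(2) z'(2) by (simp add: algebra_simps)
    then have "?A z = ?B z'" using h by simp
    moreover have "dist (?A z) (?A x) < e / 2" "dist (?B z') (?B x) < e / 2"
      using \<delta>1(2)[of z] \<delta>2(2)[of z'] z z' h by auto
    ultimately show ?thesis unfolding dist_real_def by linarith
  qed
  then have "\<bar>?A x - ?B x\<bar> \<le> 0" by (rule field_le_epsilon) simp
  then show ?thesis by simp
qed

section \<open>From real-valued to vector-valued functions, coordinate by coordinate\<close>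

lemma partial_vec_nth:
  assumes "f differentiable (at x)"
  shows "partial j (\<lambda>x. f x $ i) x = partial j f x $ i"
proof -
  have "((\<lambda>x. f x $ i) has_derivative (\<lambda>h. frechet_derivative f (at x) h $ i)) (at x)"
    using assms by (auto intro!: bounded_linear.has_derivative[OF bounded_linear_vec_nth]
        simp: frechet_derivative_works)
  then show ?thesis by (simp add: partial_def frechet_derivative_at[symmetric])
qed

lemma C_k_vec_nth: "C_k k f \<Longrightarrow> C_k k (\<lambda>x. f x $ i)"
proof (induction k arbitrary: f)
  case 0
  then show ?case by (auto intro: continuous_intros)
next
  case (Suc k)
  have f: "f differentiable (at x)" for x
    using Suc.prems by (simp add: differentiable_on_def)
  have "(\<lambda>x. f x $ i) differentiable (at x)" for x
    using f[of x] unfolding differentiable_def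
    by (blast intro: bounded_linear.has_derivative[OF bounded_linear_vec_nth])
  moreover have "partial j (\<lambda>x. f x $ i) = (\<lambda>x. partial j f x $ i)" for j
    using f by (auto simp: partial_vec_nth)
  ultimately show ?case using Suc by (simp add: differentiable_on_def)
qed

lemma smooth_differentiable: "smooth f \<Longrightarrow> f differentiable (at x)"
  unfolding smooth_def by (metis C_k.simps(2) UNIV_I differentiable_on_def)

lemma smooth_partial: "smooth f \<Longrightarrow> smooth (partial j f)"
  unfolding smooth_def by (metis C_k.simps(2))

lemma partial_commute:
  fixes f :: "real ^ 'n \<Rightarrow> real ^ 'm"
  assumes "smooth f"
  shows "partial k (partial j f) = partial j (partial k f)"
proof
  fix x
  have "partial i' (partial i (\<lambda>x. f x $ l)) x = partial i' (partial i f) x $ l" for i i' l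
  proof -
    have "partial i (\<lambda>x. f x $ l) = (\<lambda>x. partial i f x $ l)"
      using assms by (auto simp: partial_vec_nth smooth_differentiable)
    then show ?thesis using assms by (simp add: partial_vec_nth smooth_differentiable smooth_partial)
  qed
  moreover have "C_k 2 (\<lambda>x. f x $ l)" for l
    using assms C_k_vec_nth smooth_def by blast
  ultimately show "partial k (partial j f) x = partial j (partial k f) x"
    by (metis partial_commute_real vec_eq_iff)
qed

section \<open>Directional derivatives and coordinate functions\<close>

lemma frechet_derivative_eq_sum_partial:
  fixes f :: "real ^ 'n \<Rightarrow> 'b::real_normed_vector"
  assumes "f differentiable (at x)"
  shows "frechet_derivative f (at x) h = (\<Sum>j\<in>UNIV. h $ j *\<^sub>R partial j f x)"
proof -
  have "frechet_derivative f (at x) h = frechet_derivative f (at x) (\<Sum>j\<in>UNIV. h $ j *s axis j 1)"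
    by (simp add: basis_expansion)
  then show ?thesis
    using linear_frechet_derivative[OF assms]
    by (simp add: linear_sum linear_scale partial_def scalar_mult_eq_scaleR)
qed

text \<open>In this form a step of the operator is a directional derivative, accessible to the
  calculus of \<open>has_derivative\<close>.\<close>

lemma letter_op_eq:
  "\<phi> differentiable (at x) \<Longrightarrow> letter_op V i \<phi> x = frechet_derivative \<phi> (at x) (V i x)"
  by (simp add: letter_op_def grad_def inner_vec_def frechet_derivative_eq_sum_partial mult.commute)

lemma smooth_const: "smooth (\<lambda>x :: real ^ 'n. c :: 'b::real_normed_vector)"
proof -
  have [simp]: "partial j (\<lambda>x :: real ^ 'n. c) = (\<lambda>x. 0)" for j :: 'n and c :: 'b
    by (auto simp: partial_def)
  have "C_k k (\<lambda>x :: real ^ 'n. c)" for k and c :: 'b by (induction k arbitrary: c) auto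
  then show ?thesis by (simp add: smooth_def)
qed

text \<open>Relations between operators are tested on smooth functions only, so the coordinates must
  be admissible. Their first partial derivatives are constants, which reduces all higher orders to
  the constant case.\<close>

lemma smooth_vec_nth: "smooth (\<lambda>x :: real ^ 'n. x $ i)"
proof -
  have d: "((\<lambda>x :: real ^ 'n. x $ i) has_derivative (\<lambda>h. h $ i)) (at x)" for x
    by (rule bounded_linear_imp_has_derivative) (rule bounded_linear_vec_nth)
  have "partial j (\<lambda>x :: real ^ 'n. x $ i) = (\<lambda>x. axis j 1 $ i)" for j
    by (auto simp: partial_def frechet_derivative_at[OF d, symmetric])
  moreover have "(\<lambda>x::real^'n. x $ i) differentiable_on UNIV"
    using d by (auto simp: differentiable_on_def differentiable_def)
  moreover have "continuous_on UNIV (\<lambda>x::real^'n. x $ i)" by (intro continuous_intros)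
  ultimately have "C_k k (\<lambda>x::real^'n. x $ i)" for k
    using smooth_const by (cases k) (auto simp: smooth_def)
  then show ?thesis by (simp add: smooth_def)
qed

section \<open>Higher derivatives as multilinear maps\<close>

text \<open>\<open>multi_deriv [v\<^sub>1, \<dots>, v\<^sub>k] f x\<close> is the k-th derivative of f at x, evaluated at the
  vectors \<open>v\<^sub>1, \<dots>, v\<^sub>k\<close>; the vectors themselves are not differentiated.\<close>

primrec multi_deriv ::
    "(real ^ 'n) list \<Rightarrow> (real ^ 'n \<Rightarrow> real ^ 'm) \<Rightarrow> real ^ 'n \<Rightarrow> real ^ 'm" where
  "multi_deriv [] f x = f x"
| "multi_deriv (v # vs) f x = (\<Sum>j\<in>UNIV. v $ j *\<^sub>R multi_deriv vs (partial j f) x)"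

text \<open>Splitting an index list into head and tail separates the outermost sum;
  \<open>iter_partial\<close> and \<open>multi_deriv\<close> both differentiate by the head
  first.\<close>

lemma multi_deriv_eq_sum:
  fixes f :: "real ^ 'n \<Rightarrow> real ^ 'm"
  shows "(\<Sum>js | length js = length vs. (\<Prod>l<length vs. (vs ! l) $ (js ! l)) *\<^sub>R iter_partial js f x)
    = multi_deriv vs f x"
proof (induction vs arbitrary: f)
  case Nil
  then show ?case by (simp add: iter_partial_def)
next
  case (Cons v vs)
  let ?S = "{js :: 'n list. length js = length vs}"
  let ?c = "\<lambda>js. (\<Prod>l<length vs. (vs ! l) $ (js ! l))"
  have S: "{js :: 'n list. length js = length (v # vs)} = (\<lambda>(j, js). j # js) ` (UNIV \<times> ?S)"
    by (auto simp: length_Suc_conv image_iff)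
  have "inj_on (\<lambda>(j, js). j # js) (UNIV \<times> ?S)"
    by (auto simp: inj_on_def)
  then have "(\<Sum>js | length js = length (v # vs).
      (\<Prod>l<length (v # vs). ((v # vs) ! l) $ (js ! l)) *\<^sub>R iter_partial js f x)
    = (\<Sum>(j, js)\<in>UNIV \<times> ?S. (v $ j * ?c js) *\<^sub>R iter_partial js (partial j f) x)"
    unfolding S
    by (simp add: sum.reindex case_prod_unfold prod.lessThan_Suc_shift iter_partial_def
        del: prod.lessThan_Suc)
  also have "\<dots> = (\<Sum>j\<in>UNIV. v $ j *\<^sub>R (\<Sum>js\<in>?S. ?c js *\<^sub>R iter_partial js (partial j f) x))"
    by (simp add: sum.cartesian_product[symmetric] scaleR_sum_right)
  finally show ?case by (simp add: Cons.IH)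
qed

text \<open>Moving \<open>v\<close> past one vector exchanges two sums over indices and two partial
  derivatives, which commute for smooth functions. The function stays arbitrary because each vector
  passed replaces it by a partial derivative.\<close>

lemma multi_deriv_move:
  "smooth f \<Longrightarrow> multi_deriv (us @ v # vs) f x = multi_deriv (v # us @ vs) f x"
proof (induction us arbitrary: f)
  case Nil
  then show ?case by simp
next
  case (Cons u us)
  have "multi_deriv (us @ v # vs) (partial j f) x = multi_deriv (v # us @ vs) (partial j f) x" for j
    by (rule Cons.IH) (rule smooth_partial[OF Cons.prems])
  then have "multi_deriv ((u # us) @ v # vs) f x
    = (\<Sum>j\<in>UNIV. \<Sum>k\<in>UNIV. (u $ j * v $ k) *\<^sub>R multi_deriv (us @ vs) (partial k (partial j f)) x)"
    by (simp only: append_Cons multi_deriv.simps scaleR_sum_right scaleR_scaleR)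
  also have "\<dots>
    = (\<Sum>k\<in>UNIV. \<Sum>j\<in>UNIV. (v $ k * u $ j) *\<^sub>R multi_deriv (us @ vs) (partial j (partial k f)) x)"
    by (subst sum.swap)
      (intro sum.cong refl arg_cong2[where f = scaleR] mult.commute
        arg_cong[where f = "\<lambda>f. multi_deriv (us @ vs) f x"] partial_commute Cons.prems)
  also have "\<dots> = multi_deriv (v # (u # us) @ vs) f x"
    by (simp only: append_Cons multi_deriv.simps scaleR_sum_right scaleR_scaleR)
  finally show ?case .
qed

text \<open>Symmetry of the multilinear form; it makes the enumeration of the branches chosen in
  \<open>graft\<close> immaterial.\<close>

lemma multi_deriv_mset_cong:
  "mset us = mset vs \<Longrightarrow> smooth f \<Longrightarrow> multi_deriv us f x = multi_deriv vs f x"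
proof (induction us arbitrary: f vs)
  case Nil
  then show ?case by simp
next
  case (Cons u us)
  then have "u \<in> set vs" by (metis list.set_intros(1) set_mset_mset)
  then obtain as bs where vs: "vs = as @ u # bs" by (meson split_list)
  then have "mset us = mset (as @ bs)" using Cons.prems(1) by simp
  then show ?case
    using Cons.IH[of "as @ bs"] Cons.prems(2) vs by (simp add: multi_deriv_move smooth_partial)
qed

lemma graft_eq_multi_deriv:
  assumes "smooth f"
  shows "graft f (mset gs) x = multi_deriv (map (\<lambda>g. g x) gs) f x"
proof -
  define gs' where "gs' = (SOME gs'. mset gs' = mset gs)"
  have gs': "mset gs' = mset gs" unfolding gs'_def by (rule someI) (rule refl)
  have "graft f (mset gs) x = multi_deriv (map (\<lambda>g. g x) gs') f x"
    unfolding graft_def Let_def gs'_def[symmetric] multi_deriv_eq_sum[symmetric]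
    by simp
  also have "\<dots> = multi_deriv (map (\<lambda>g. g x) gs) f x"
    using gs' assms by (intro multi_deriv_mset_cong) simp_all
  finally show ?thesis .
qed

text \<open>The branches are indexed by \<open>cs\<close> through \<open>t\<close>, so that
  isomorphic branches at different vertices stay apart when one of them is differentiated.\<close>

lemma tree_field_Node:
  "smooth (V a) \<Longrightarrow> tree_field V (Node a (image_mset t (mset cs))) x
    = multi_deriv (map (\<lambda>c. tree_field V (t c) x) cs) (V a) x"
  using graft_eq_multi_deriv[of "V a" "map (\<lambda>c. tree_field V (t c)) cs" x]
  by (simp add: image_mset.compositionality comp_def)

text \<open>Linearity in the slot of \<open>c\<close>; distinctness ensures that the update touches
  no other slot.\<close>

lemma multi_deriv_update_sum:
  "distinct cs \<Longrightarrow> c \<in> set cs \<Longrightarrow> multi_deriv (map (g(c := \<Sum>u\<in>U. h u)) cs) f x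
    = (\<Sum>u\<in>U. multi_deriv (map (g(c := h u)) cs) f x)"
proof (induction cs arbitrary: f)
  case Nil
  then show ?case by simp
next
  case (Cons a cs)
  show ?case
  proof (cases "a = c")
    case True
    then have "c \<notin> set cs" using Cons.prems by simp
    then have upd: "multi_deriv (map (g(c := y)) (a # cs)) f x
      = (\<Sum>j\<in>UNIV. y $ j *\<^sub>R multi_deriv (map g cs) (partial j f) x)" for y
      by (simp only: True list.map multi_deriv.simps fun_upd_same map_fun_upd if_False simp_thms)
    show ?thesis
      unfolding upd sum_component scaleR_sum_left by (rule sum.swap)
  next
    case False
    then have c: "distinct cs" "c \<in> set cs" using Cons.prems by auto
    have "(g(c := y)) a = g a" for y using False by simp
    then have upd: "multi_deriv (map (g(c := y)) (a # cs)) f x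
      = (\<Sum>j\<in>UNIV. g a $ j *\<^sub>R multi_deriv (map (g(c := y)) cs) (partial j f) x)" for y
      by (simp only: list.map multi_deriv.simps)
    show ?thesis
      unfolding upd Cons.IH[OF c] scaleR_sum_right by (rule sum.swap)
  qed
qed

text \<open>Leibniz rule: the derivative falls either on \<open>f\<close>, adding the direction
  \<open>h\<close> as a further argument, or on one of the vectors, replacing it in its
  slot.\<close>

lemma multi_deriv_has_derivative:
  assumes "smooth f" "distinct cs" "\<And>c. c \<in> set cs \<Longrightarrow> (g c has_derivative g' c) (at x)"
  shows "((\<lambda>y. multi_deriv (map (\<lambda>c. g c y) cs) f y) has_derivative
    (\<lambda>h. multi_deriv (h # map (\<lambda>c. g c x) cs) f x
      + (\<Sum>c\<in>set cs. multi_deriv (map ((\<lambda>c. g c x)(c := g' c h)) cs) f x))) (at x)"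
  using assms
proof (induction cs arbitrary: f)
  case Nil
  then have "f differentiable (at x)" by (simp add: smooth_differentiable)
  then show ?case
    by (simp flip: frechet_derivative_eq_sum_partial frechet_derivative_works)
next
  case (Cons a cs)
  let ?g = "\<lambda>c. g c x"
  let ?D = "\<lambda>f h. multi_deriv (h # map ?g cs) f x
      + (\<Sum>c\<in>set cs. multi_deriv (map (?g(c := g' c h)) cs) f x)"
  have "((\<lambda>y. g a y $ j) has_derivative (\<lambda>h. g' a h $ j)) (at x)" for j
    using Cons.prems by (auto intro: bounded_linear.has_derivative[OF bounded_linear_vec_nth])
  moreover have "((\<lambda>y. multi_deriv (map (\<lambda>c. g c y) cs) (partial j f) y) has_derivative
      ?D (partial j f)) (at x)" for j
    by (rule Cons.IH) (use Cons.prems in \<open>auto simp: smooth_partial\<close>)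
  ultimately have "((\<lambda>y. multi_deriv (map (\<lambda>c. g c y) (a # cs)) f y) has_derivative
      (\<lambda>h. \<Sum>j\<in>UNIV. g a x $ j *\<^sub>R ?D (partial j f) h
        + g' a h $ j *\<^sub>R multi_deriv (map ?g cs) (partial j f) x)) (at x)"
    unfolding list.map multi_deriv.simps(2)
    by (intro has_derivative_sum has_derivative_scaleR)
  moreover have "(\<Sum>j\<in>UNIV. g a x $ j *\<^sub>R ?D (partial j f) h
        + g' a h $ j *\<^sub>R multi_deriv (map ?g cs) (partial j f) x)
      = multi_deriv (h # map ?g (a # cs)) f x
        + (\<Sum>c\<in>set (a # cs). multi_deriv (map (?g(c := g' c h)) (a # cs)) f x)" for h
  proof -
    have "(\<Sum>j\<in>UNIV. g a x $ j *\<^sub>R ?D (partial j f) h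
        + g' a h $ j *\<^sub>R multi_deriv (map ?g cs) (partial j f) x)
      = multi_deriv (?g a # h # map ?g cs) f x
        + (\<Sum>c\<in>set cs. multi_deriv (?g a # map (?g(c := g' c h)) cs) f x)
        + multi_deriv (g' a h # map ?g cs) f x"
      by (simp add: sum.distrib scaleR_add_right scaleR_sum_right sum.swap[of _ "set cs"]
          del: fun_upd_apply)
    \<comment> \<open>Differentiating the inner form places \<open>h\<close> behind the first
      vector; symmetry brings it to the front.\<close>
    also have "multi_deriv (?g a # h # map ?g cs) f x = multi_deriv (h # map ?g (a # cs)) f x"
      using multi_deriv_move[OF Cons.prems(1), of "[?g a]" h "map ?g cs"] by simp
    also have "(\<Sum>c\<in>set cs. multi_deriv (?g a # map (?g(c := g' c h)) cs) f x)
      = (\<Sum>c\<in>set cs. multi_deriv (map (?g(c := g' c h)) (a # cs)) f x)"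
      using Cons.prems(2) by (intro sum.cong) auto
    also have "multi_deriv (g' a h # map ?g cs) f x
      = multi_deriv (map (?g(a := g' a h)) (a # cs)) f x"
      using Cons.prems(2) by simp
    finally show ?thesis
      using Cons.prems(2) by (simp add: add_ac del: multi_deriv.simps list.map fun_upd_apply)
  qed
  ultimately show ?case by (simp only:)
qed

section \<open>Growing a recursive tree by one leaf\<close>

lemma recursive_treesD:
  "p \<in> recursive_trees m \<Longrightarrow> l \<in> {2..m} \<Longrightarrow> 1 \<le> p l \<and> p l < l"
  unfolding recursive_trees_def by (drule PiE_mem) auto

text \<open>The bound \<open>v < l\<close> repeats that of \<open>subtree\<close>, so the recursion
  unfolds for every \<open>p\<close>.\<close>

definition children :: "(nat \<Rightarrow> nat) \<Rightarrow> nat \<Rightarrow> nat \<Rightarrow> nat set"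
  where "children p m v = {l \<in> {v<..m}. p l = v}"

definition edges :: "(nat \<Rightarrow> nat) \<Rightarrow> nat \<Rightarrow> (nat \<times> nat) set"
  where "edges p m = (\<lambda>l. (p l, l)) ` {2..m}"

text \<open>Since \<open>v\<close> itself is included, these are the positions at which a new leaf
  changes the subtree at \<open>v\<close>.\<close>

definition descendants :: "(nat \<Rightarrow> nat) \<Rightarrow> nat \<Rightarrow> nat \<Rightarrow> nat set"
  where "descendants p m v = (edges p m)\<^sup>* `` {v}"

lemma finite_children [simp]: "finite (children p m v)"
  by (simp add: children_def)

lemma children_iff_edge:
  "p \<in> recursive_trees m \<Longrightarrow> 1 \<le> v \<Longrightarrow> l \<in> children p m v \<longleftrightarrow> (v, l) \<in> edges p m"
  using recursive_treesD[of p m l] by (auto simp: children_def edges_def)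

lemma descendants_ge:
  assumes "p \<in> recursive_trees m" "u \<in> descendants p m v"
  shows "v \<le> u"
proof -
  have "(v, u) \<in> (edges p m)\<^sup>*" using assms(2) by (simp add: descendants_def)
  then show ?thesis
  proof induction
    case (step y z)
    then show ?case using recursive_treesD[OF assms(1), of z] by (auto simp: edges_def)
  qed simp
qed

lemma descendants_le:
  assumes "u \<in> descendants p m v" "v \<le> m"
  shows "u \<le> m"
proof -
  have "(v, u) \<in> (edges p m)\<^sup>*" using assms(1) by (simp add: descendants_def)
  then show ?thesis by (cases rule: rtranclE) (use assms(2) in \<open>auto simp: edges_def\<close>)
qed

lemma descendants_rec:
  assumes "p \<in> recursive_trees m" "1 \<le> v"
  shows "descendants p m v = insert v (\<Union>c\<in>children p m v. descendants p m c)"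
proof -
  have "(v, u) \<in> (edges p m)\<^sup>* \<longleftrightarrow> v = u \<or> (\<exists>c. (v, c) \<in> edges p m \<and> (c, u) \<in> (edges p m)\<^sup>*)" for u
    by (meson converse_rtranclE converse_rtrancl_into_rtrancl rtrancl.rtrancl_refl)
  then show ?thesis using assms by (auto simp: descendants_def children_iff_edge)
qed

text \<open>Parents are unique, so of two ancestors of a common vertex one descends from the other.
  Between siblings such a path would lead through their parent, whose number is smaller than that of
  either.\<close>

lemma descendants_disjoint:
  assumes p: "p \<in> recursive_trees m" and c: "c \<in> children p m v" "c' \<in> children p m v" "c \<noteq> c'"
  shows "descendants p m c \<inter> descendants p m c' = {}"
proof (rule ccontr)
  have not_desc: "(b, b') \<notin> (edges p m)\<^sup>*"
    if "b \<in> children p m v" "b' \<in> children p m v" "b \<noteq> b'" for b b'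
  proof
    assume "(b, b') \<in> (edges p m)\<^sup>*"
    then obtain y where "(b, y) \<in> (edges p m)\<^sup>*" "(y, b') \<in> edges p m"
      using \<open>b \<noteq> b'\<close> by (cases rule: rtranclE) auto
    then have "(b, v) \<in> (edges p m)\<^sup>*" using that(2) by (auto simp: edges_def children_def)
    then have "b \<le> v" using descendants_ge[OF p] by (simp add: descendants_def)
    then show False using that(1) by (simp add: children_def)
  qed
  assume "descendants p m c \<inter> descendants p m c' \<noteq> {}"
  then obtain u where "(u, c) \<in> ((edges p m)\<inverse>)\<^sup>*" "(u, c') \<in> ((edges p m)\<inverse>)\<^sup>*"
    by (auto simp: descendants_def rtrancl_converse)
  moreover have "single_valued ((edges p m)\<inverse>)"
    by (auto simp: single_valued_def edges_def)
  ultimately have "(c, c') \<in> ((edges p m)\<inverse>)\<^sup>* \<or> (c', c) \<in> ((edges p m)\<inverse>)\<^sup>*"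
    using single_valued_confluent by metis
  then show False
    using not_desc[OF c] not_desc[OF c(2,1) c(3)[symmetric]] unfolding rtrancl_converse by simp
qed

lemma parent_not_descendant:
  "p \<in> recursive_trees m \<Longrightarrow> c \<in> children p m v \<Longrightarrow> v \<notin> descendants p m c"
  using descendants_ge[of p m v c] by (auto simp: children_def)

text \<open>Following parents lowers the number until 1 is reached. Hence at the root a sum over
  descendants runs over all vertices.\<close>

lemma descendants_root:
  assumes "p \<in> recursive_trees m" "1 \<le> m"
  shows "descendants p m 1 = {1..m}"
proof -
  have "(1, u) \<in> (edges p m)\<^sup>*" if "u \<in> {1..m}" for u
    using that
  proof (induction u rule: less_induct)
    case (less u)
    show ?case
    proof (cases "u = 1")
      case False
      then have u: "u \<in> {2..m}" using less.prems by simp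
      then have "p u < u" "p u \<in> {1..m}" using recursive_treesD[OF assms(1) u] by auto
      then have "(1, p u) \<in> (edges p m)\<^sup>*" by (rule less.IH)
      moreover have "(p u, u) \<in> edges p m" using u by (auto simp: edges_def)
      ultimately show ?thesis by (rule rtrancl_into_rtrancl)
    qed simp
  qed
  then have "{1..m} \<subseteq> descendants p m 1" by (auto simp: descendants_def)
  then show ?thesis
    using descendants_ge[OF assms(1), of _ 1] descendants_le[of _ p m 1] assms(2) by auto
qed

section \<open>How a new leaf changes the subtrees and their fields\<close>

lemma subtree_eq_Node:
  assumes "distinct cs" "set cs = children p (length w) v"
  shows "subtree w p v = Node (w ! (v - 1)) (image_mset (subtree w p) (mset cs))"
  using assms mset_set_set[of cs]
  by (subst subtree.simps) (simp add: children_def)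

lemma children_grow:
  assumes "v \<le> m"
  shows "children (p(Suc m := u)) (Suc m) v
    = (if u = v then insert (Suc m) (children p m v) else children p m v)"
  using assms by (auto simp: children_def)

lemma subtree_new_leaf: "subtree (w @ [i]) p (Suc (length w)) = Node i {#}"
  by (subst subtree_eq_Node[of "[]"]) (auto simp: children_def)

text \<open>A leaf hung outside the subtree at \<open>v\<close> is not seen from \<open>v\<close>.
  Children carry larger numbers, so the distance to the last vertex serves as induction
  measure.\<close>

lemma subtree_grow_elsewhere:
  assumes p: "p \<in> recursive_trees (length w)"
  shows "v \<in> {1..length w} \<Longrightarrow> u \<notin> descendants p (length w) v \<Longrightarrow>
    subtree (w @ [i]) (p(Suc (length w) := u)) v = subtree w p v"
proof (induction "length w - v" arbitrary: v rule: less_induct)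
  case less
  let ?m = "length w"
  define cs where "cs = sorted_list_of_set (children p ?m v)"
  have cs: "distinct cs" "set cs = children p ?m v" by (simp_all add: cs_def)
  have "u \<noteq> v" and u: "\<And>c. c \<in> set cs \<Longrightarrow> u \<notin> descendants p ?m c"
    using less.prems descendants_rec[OF p, of v] cs by auto
  then have "subtree (w @ [i]) (p(Suc ?m := u)) v
    = Node ((w @ [i]) ! (v - 1)) (image_mset (subtree (w @ [i]) (p(Suc ?m := u))) (mset cs))"
    using cs less.prems by (intro subtree_eq_Node) (auto simp: children_grow)
  also have "image_mset (subtree (w @ [i]) (p(Suc ?m := u))) (mset cs)
      = image_mset (subtree w p) (mset cs)"
    using less u cs by (intro image_mset_cong) (auto simp: children_def)
  finally show ?case
    using subtree_eq_Node[OF cs] nth_append_left[of "v - 1" w "[i]"] less.prems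
    by (metis One_nat_def Suc_pred' atLeastAtMost_iff less_eq_Suc_le)
qed

text \<open>The claim covers every vertex \<open>v\<close> so that the induction can climb from the
  leaves to the root. Differentiability is carried along because the Leibniz rule needs it for the
  branches.\<close>

lemma tree_field_derivative:
  fixes V :: "nat \<Rightarrow> real ^ 'n \<Rightarrow> real ^ 'n"
  assumes p: "p \<in> recursive_trees (length w)" and V: "\<And>i. i \<in> set w \<Longrightarrow> smooth (V i)"
  shows "v \<in> {1..length w} \<Longrightarrow> tree_field V (subtree w p v) differentiable (at x) \<and>
    frechet_derivative (tree_field V (subtree w p v)) (at x) (V i x)
      = (\<Sum>u\<in>descendants p (length w) v.
          tree_field V (subtree (w @ [i]) (p(Suc (length w) := u)) v) x)"
proof (induction "length w - v" arbitrary: v rule: less_induct)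
  case less
  let ?m = "length w"
  let ?a = "w ! (v - 1)"
  let ?C = "children p ?m v"
  let ?D = "descendants p ?m"
  let ?F = "\<lambda>c. tree_field V (subtree w p c)"
  let ?s = "\<lambda>u. subtree (w @ [i]) (p(Suc ?m := u))"
  define cs where "cs = sorted_list_of_set ?C"
  have cs: "distinct cs" "set cs = ?C" by (simp_all add: cs_def)
  have C: "c \<in> {1..?m}" "v < c" if "c \<in> ?C" for c using that by (auto simp: children_def)
  have a: "smooth (V ?a)" using V less.prems by (auto intro!: nth_mem)
  have a': "(w @ [i]) ! (v - 1) = ?a" using less.prems by (auto simp: nth_append)
  have F: "?F v = (\<lambda>x. multi_deriv (map (\<lambda>c. ?F c x) cs) (V ?a) x)"
    using a by (subst subtree_eq_Node[OF cs]) (intro ext tree_field_Node)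
  have IH: "?F c differentiable (at x)"
    "frechet_derivative (?F c) (at x) (V i x) = (\<Sum>u\<in>?D c. tree_field V (?s u c) x)"
    if "c \<in> ?C" for c
    by (rule less.hyps[THEN conjunct1] less.hyps[THEN conjunct2],
        use C[OF that] less.prems in \<open>auto simp: less_imp_le\<close>)+
  have deriv: "(?F v has_derivative
    (\<lambda>h. multi_deriv (h # map (\<lambda>c. ?F c x) cs) (V ?a) x
      + (\<Sum>c\<in>set cs. multi_deriv
          (map ((\<lambda>c. ?F c x)(c := frechet_derivative (?F c) (at x) h)) cs) (V ?a) x))) (at x)"
    (is "(_ has_derivative ?F') _")
    unfolding F
  proof (rule multi_deriv_has_derivative[OF a cs(1), where g = ?F
        and g' = "\<lambda>c. frechet_derivative (?F c) (at x)"])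
    show "(?F c has_derivative frechet_derivative (?F c) (at x)) (at x)" if "c \<in> set cs" for c
      using IH(1)[OF that[unfolded cs(2)]] by (rule frechet_derivative_works[THEN iffD1])
  qed
  \<comment> \<open>The leaf hangs at \<open>v\<close> itself: it is a new branch with field
    \<open>V i\<close>, hence a further argument \<open>V i x\<close>. This is the first term of the
    Leibniz rule.\<close>
  have at_v: "tree_field V (?s v v) x = multi_deriv (V i x # map (\<lambda>c. ?F c x) cs) (V ?a) x"
  proof -
    have "distinct (Suc ?m # cs)"
      "set (Suc ?m # cs) = children (p(Suc ?m := v)) (length (w @ [i])) v"
      using cs less.prems by (auto simp: children_grow) (auto simp: children_def)
    note eq = subtree_eq_Node[OF this, unfolded a']
    have "map (\<lambda>c. tree_field V (?s v c) x) cs = map (\<lambda>c. ?F c x) cs"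
    proof (rule map_cong[OF refl])
      fix c assume "c \<in> set cs"
      then have c: "c \<in> ?C" using cs by simp
      show "tree_field V (?s v c) x = ?F c x"
        by (simp only: subtree_grow_elsewhere[OF p C(1)[OF c] parent_not_descendant[OF p c]])
    qed
    then show ?thesis
      unfolding eq tree_field_Node[where V = V and a = ?a, OF a]
      by (simp only: list.map subtree_new_leaf tree_field_bullet)
  qed
  \<comment> \<open>The leaf hangs inside branch \<open>c\<close>: the branches are disjoint, so
    only the slot of \<open>c\<close> changes.\<close>
  have below: "tree_field V (?s u v) x
      = multi_deriv (map ((\<lambda>c. ?F c x)(c := tree_field V (?s u c) x)) cs) (V ?a) x"
    if c: "c \<in> ?C" and u: "u \<in> ?D c" for c u
  proof -
    have "u \<noteq> v" using parent_not_descendant[OF p c] u by auto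
    then have "set cs = children (p(Suc ?m := u)) (length (w @ [i])) v"
      using cs less.prems by (simp add: children_grow)
    note eq = subtree_eq_Node[OF cs(1) this, unfolded a']
    have "map (\<lambda>c. tree_field V (?s u c) x) cs
        = map ((\<lambda>c. ?F c x)(c := tree_field V (?s u c) x)) cs"
    proof (rule map_cong[OF refl])
      fix b assume "b \<in> set cs"
      then have b: "b \<in> ?C" using cs by simp
      show "tree_field V (?s u b) x = ((\<lambda>c. ?F c x)(c := tree_field V (?s u c) x)) b"
      proof (cases "b = c")
        case False
        then have "u \<notin> ?D b" using descendants_disjoint[OF p b c] u by blast
        with False show ?thesis
          by (simp only: subtree_grow_elsewhere[OF p C(1)[OF b]] fun_upd_other not_False_eq_True)
      qed simp
    qed
    then show ?thesis unfolding eq tree_field_Node[where V = V and a = ?a, OF a] by (simp only:)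
  qed
  have "finite (?D c)" if "c \<in> ?C" for c
    using descendants_le C[OF that] by (meson atLeastAtMost_iff finite_nat_set_iff_bounded_le)
  note fin = this
  \<comment> \<open>The positions of the leaf are split into \<open>v\<close> and the branches,
    matching the two kinds of terms of the Leibniz rule.\<close>
  have "v \<notin> (\<Union>c\<in>?C. ?D c)" using parent_not_descendant[OF p] by blast
  moreover have "?D v = insert v (\<Union>c\<in>?C. ?D c)"
    using less.prems by (intro descendants_rec[OF p]) simp
  moreover have "finite (\<Union>c\<in>?C. ?D c)" using fin by simp
  ultimately have "(\<Sum>u\<in>?D v. tree_field V (?s u v) x)
    = tree_field V (?s v v) x + (\<Sum>u\<in>(\<Union>c\<in>?C. ?D c). tree_field V (?s u v) x)"
    by (simp only: sum.insert not_False_eq_True)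
  also have "(\<Sum>u\<in>(\<Union>c\<in>?C. ?D c). tree_field V (?s u v) x)
    = (\<Sum>c\<in>?C. \<Sum>u\<in>?D c. tree_field V (?s u v) x)"
    using descendants_disjoint[OF p] fin by (intro sum.UNION_disjoint) auto
  also have "\<dots> = (\<Sum>c\<in>set cs. multi_deriv
      (map ((\<lambda>c. ?F c x)(c := frechet_derivative (?F c) (at x) (V i x))) cs) (V ?a) x)"
    unfolding cs(2)
  proof (rule sum.cong[OF refl])
    fix c assume c: "c \<in> ?C"
    \<comment> \<open>By induction the derivative of branch \<open>c\<close> is a sum over leaf
      positions, which linearity in its slot pulls out.\<close>
    show "(\<Sum>u\<in>?D c. tree_field V (?s u v) x) = multi_deriv
      (map ((\<lambda>c. ?F c x)(c := frechet_derivative (?F c) (at x) (V i x))) cs) (V ?a) x"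
      unfolding IH(2)[OF c] multi_deriv_update_sum[OF cs(1) c[folded cs(2)]]
      by (rule sum.cong[OF refl]) (rule below[OF c])
  qed
  also have "tree_field V (?s v v) x + \<dots> = ?F' (V i x)"
    unfolding at_v by (rule refl)
  also have "?F' = frechet_derivative (?F v) (at x)"
    by (rule frechet_derivative_at[OF deriv])
  finally have "frechet_derivative (?F v) (at x) (V i x) = (\<Sum>u\<in>?D v. tree_field V (?s u v) x)"
    by (rule sym)
  moreover have "?F v differentiable (at x)"
    using deriv by (rule differentiableI)
  ultimately show ?case by (intro conjI)
qed

section \<open>Expansion of the iterated operators\<close>

lemma unnumbered_single: "unnumbered [i] p = Node i {#}"
  unfolding unnumbered_def by (subst subtree_eq_Node[of "[]"]) (auto simp: children_def)

lemma finite_recursive_trees: "finite (recursive_trees m)"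
  unfolding recursive_trees_def by (intro finite_PiE) auto

text \<open>No vertex has a parent here, and the only extensional function on the empty domain is
  constantly \<open>undefined\<close>.\<close>

lemma recursive_trees_1: "recursive_trees 1 = {\<lambda>_. undefined}"
  by (simp add: recursive_trees_def)

text \<open>A tree of order \<open>Suc m\<close> is uniquely a tree of order \<open>m\<close>
  together with a parent for the new last vertex. For order 0 this fails, since vertex 1 has no
  parent.\<close>

lemma sum_recursive_trees_Suc:
  fixes f :: "(nat \<Rightarrow> nat) \<Rightarrow> 'a::comm_monoid_add"
  assumes "1 \<le> m"
  shows "sum f (recursive_trees (Suc m)) = (\<Sum>p\<in>recursive_trees m. \<Sum>u\<in>{1..m}. f (p(Suc m := u)))"
proof -
  have "{2..Suc m} = insert (Suc m) {2..m}" using assms by auto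
  then have R: "recursive_trees (Suc m) = (\<lambda>(u, p). p(Suc m := u)) ` ({1..m} \<times> recursive_trees m)"
    by (simp add: recursive_trees_def PiE_insert_eq atLeastLessThanSuc_atLeastAtMost)
  have "inj_on (\<lambda>(u, p). p(Suc m := u)) ({1..m} \<times> recursive_trees m)"
    using inj_combinator[of "Suc m" "{2..m}" "\<lambda>l. {1..<l}"]
    by (simp add: recursive_trees_def atLeastLessThanSuc_atLeastAtMost)
  then have "sum f (recursive_trees (Suc m)) = (\<Sum>(u, p)\<in>{1..m} \<times> recursive_trees m. f (p(Suc m := u)))"
    unfolding R by (simp add: sum.reindex case_prod_unfold)
  also have "\<dots> = (\<Sum>p\<in>recursive_trees m. \<Sum>u\<in>{1..m}. f (p(Suc m := u)))"
    by (subst sum.swap) (simp add: sum.cartesian_product)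
  finally show ?thesis .
qed

text \<open>The induction extends the word on the right, since the last letter acts last and creates
  the vertex with the largest number.\<close>

lemma word_op_coordinate:
  fixes V :: "nat \<Rightarrow> real ^ 'n \<Rightarrow> real ^ 'n"
  assumes "w \<noteq> []" "\<And>i. i \<in> set w \<Longrightarrow> smooth (V i)"
  shows "word_op V w (\<lambda>x. x $ j) x
    = (\<Sum>p\<in>recursive_trees (length w). tree_field V (unnumbered w p) x) $ j"
  using assms
proof (induction w arbitrary: x rule: rev_induct)
  case Nil
  then show ?case by simp
next
  case (snoc i w)
  show ?case
  proof (cases "w = []")
    case True
    have "((\<lambda>x :: real ^ 'n. x $ j) has_derivative (\<lambda>h. h $ j)) (at x)"
      by (rule bounded_linear_imp_has_derivative) (rule bounded_linear_vec_nth)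
    then have "letter_op V i (\<lambda>x. x $ j) x = V i x $ j"
      by (simp add: letter_op_eq differentiableI frechet_derivative_at[symmetric])
    then show ?thesis
      using True recursive_trees_1 by (simp add: word_op_single unnumbered_single tree_field_bullet del: tree_field.simps)
  next
    case False
    let ?m = "length w"
    let ?F = "\<lambda>p. tree_field V (unnumbered w p)"
    let ?G = "\<lambda>p. tree_field V (unnumbered (w @ [i]) p)"
    have m: "1 \<le> ?m" using False by (simp add: Suc_le_eq)
    have "?F p differentiable (at x) \<and> frechet_derivative (?F p) (at x) (V i x)
        = (\<Sum>u\<in>{1..?m}. ?G (p(Suc ?m := u)) x)" if "p \<in> recursive_trees ?m" for p
      using tree_field_derivative[of p w V 1 x i] that snoc.prems(2) m descendants_root[OF that m]
      by (simp add: unnumbered_def)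
    then have d: "(?F p has_derivative frechet_derivative (?F p) (at x)) (at x)"
      and G: "frechet_derivative (?F p) (at x) (V i x) = (\<Sum>u\<in>{1..?m}. ?G (p(Suc ?m := u)) x)"
      if "p \<in> recursive_trees ?m" for p
      using that frechet_derivative_works by blast+
    have "((\<lambda>x. (\<Sum>p\<in>recursive_trees ?m. ?F p x) $ j) has_derivative
      (\<lambda>h. (\<Sum>p\<in>recursive_trees ?m. frechet_derivative (?F p) (at x) h) $ j)) (at x)"
      by (intro bounded_linear.has_derivative[OF bounded_linear_vec_nth] has_derivative_sum d)
    moreover have "word_op V w (\<lambda>x. x $ j) = (\<lambda>x. (\<Sum>p\<in>recursive_trees ?m. ?F p x) $ j)"
      using snoc.IH[OF False] snoc.prems(2) by auto
    ultimately have "word_op V (w @ [i]) (\<lambda>x. x $ j) x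
        = (\<Sum>p\<in>recursive_trees ?m. frechet_derivative (?F p) (at x) (V i x)) $ j"
      by (simp only: word_op_snoc letter_op_eq[OF differentiableI] frechet_derivative_at[symmetric])
    also have "\<dots> = (\<Sum>p\<in>recursive_trees ?m. \<Sum>u\<in>{1..?m}. ?G (p(Suc ?m := u)) x) $ j"
      by (intro arg_cong[where f = "\<lambda>v. v $ j"] sum.cong refl G)
    also have "\<dots> = (\<Sum>p\<in>recursive_trees (length (w @ [i])). ?G p x) $ j"
      using m by (simp only: sum_recursive_trees_Suc length_append_singleton)
    finally show ?thesis .
  qed
qed

section \<open>Ladder trees\<close>

text \<open>The path 1, 2, ..., m; the restriction to \<open>{2..m}\<close> keeps it extensional, as
  \<open>recursive_trees\<close> demands.\<close>

definition ladder :: "nat \<Rightarrow> nat \<Rightarrow> nat"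
  where "ladder m = (\<lambda>l\<in>{2..m}. l - 1)"

lemma ladder_in_recursive_trees: "ladder m \<in> recursive_trees m"
  by (auto simp: ladder_def recursive_trees_def)

lemma children_ladder: "1 \<le> v \<Longrightarrow> v < m \<Longrightarrow> children (ladder m) m v = {Suc v}"
  by (auto simp: ladder_def children_def)

text \<open>Above its last vertex a ladder has one branch at each vertex, and equality of the branch
  multisets forces a single child in the other tree as well.\<close>

lemma subtree_eq_ladder_step:
  assumes "subtree w p v = subtree w' (ladder m) v" "length w = m" "length w' = m"
    "1 \<le> v" "v < m"
  obtains l where "children p m v = {l}" "subtree w p l = subtree w' (ladder m) (Suc v)"
proof -
  define cs where "cs = sorted_list_of_set (children p m v)"
  have cs: "distinct cs" "set cs = children p m v" by (simp_all add: cs_def)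
  have "image_mset (subtree w p) (mset cs) = {#subtree w' (ladder m) (Suc v)#}"
    using assms(1) subtree_eq_Node[of cs p w v] subtree_eq_Node[of "[Suc v]" "ladder m" w' v]
      cs assms(2-5) children_ladder by simp
  then obtain l where "mset cs = {#l#}" "subtree w p l = subtree w' (ladder m) (Suc v)"
    by (auto dest!: msed_map_invR)
  then show ?thesis using that cs by auto
qed

lemma unnumbered_eq_ladder:
  assumes w: "length w = m" "length w' = m" and p: "p \<in> recursive_trees m"
    and eq: "unnumbered w p = unnumbered w' (ladder m)"
  shows "w = w' \<and> p = ladder m"
proof -
  \<comment> \<open>Both claims are proved together: equality of the subtrees at a vertex limits its
    children, which determines the parent of the next vertex.\<close>
  have *: "(\<forall>l\<in>{2..v}. p l = l - 1) \<and> (\<forall>l\<in>{1..v}. subtree w p l = subtree w' (ladder m) l)"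
    if "v \<le> m" for v
    using that
  proof (induction v)
    case (Suc v)
    then have IH: "\<And>l. l \<in> {2..v} \<Longrightarrow> p l = l - 1"
      "\<And>l. l \<in> {1..v} \<Longrightarrow> subtree w p l = subtree w' (ladder m) l" by auto
    show ?case
    proof (cases "v = 0")
      case True
      then show ?thesis using eq by (simp add: unnumbered_def)
    next
      case False
      \<comment> \<open>If the parent \<open>a\<close> of \<open>Suc v\<close> were smaller than
        \<open>v\<close>, it would have both \<open>Suc a\<close> and \<open>Suc v\<close> as
        children, but it has only one.\<close>
      define a where "a = p (Suc v)"
      have a: "1 \<le> a" "a \<le> v"
        using recursive_treesD[OF p, of "Suc v"] False Suc.prems by (auto simp: a_def)
      obtain l where l: "children p m a = {l}" "subtree w p l = subtree w' (ladder m) (Suc a)"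
        by (rule subtree_eq_ladder_step[OF IH(2) w]) (use a Suc.prems in auto)
      have "Suc v \<in> children p m a" using a Suc.prems by (auto simp: children_def a_def)
      moreover have "Suc a \<in> children p m a" if "a < v"
        using that a IH(1)[of "Suc a"] Suc.prems by (auto simp: children_def)
      ultimately have "a = v" "l = Suc v" using a l(1) by fastforce+
      then show ?thesis
        using IH l(2) False by (auto simp: a_def atLeastAtMostSuc_conv)
    qed
  qed simp
  have nth: "w ! (l - 1) = w' ! (l - 1)" if "l \<in> {1..m}" for l
  proof -
    have "subtree w p l = subtree w' (ladder m) l" using * that by blast
    then show ?thesis by (subst (asm) (1 2) subtree.simps) simp
  qed
  have "w ! l = w' ! l" if "l < m" for l using nth[of "Suc l"] that by simp
  then have "w = w'" using w by (intro nth_equalityI) auto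
  moreover have "p = ladder m"
  proof (rule PiE_ext)
    show "p \<in> (\<Pi>\<^sub>E l\<in>{2..m}. {1..<l})" "ladder m \<in> (\<Pi>\<^sub>E l\<in>{2..m}. {1..<l})"
      using p ladder_in_recursive_trees[of m] by (simp_all add: recursive_trees_def)
    show "p l = ladder m l" if "l \<in> {2..m}" for l using *[of m] that by (simp add: ladder_def)
  qed
  ultimately show ?thesis by simp
qed

section \<open>Transfer of a linear relation from the operators to the tree-like fields\<close>

theorem proposition3p6:
  fixes V :: "nat \<Rightarrow> real ^ 'n \<Rightarrow> real ^ 'n" and d m :: nat
  assumes "d \<ge> 1" and "m \<ge> 1"
    and "\<And>i. i \<in> {1..d} \<Longrightarrow> smooth (V i)"
    and "fields_lin_indep V (trees d m)"
  shows "operators_lin_indep V (words d m)"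
  unfolding operators_lin_indep_def lin_indep_family_def
proof (intro allI impI ballI)
  fix J and c :: "nat list \<Rightarrow> real" and w\<^sub>0
  assume J: "finite J \<and> J \<subseteq> words d m \<and> (\<forall>x\<in>Collect smooth \<times> UNIV.
    (\<Sum>w\<in>J. c w *\<^sub>R (case x of (\<phi>, x) \<Rightarrow> word_op V w \<phi> x)) = 0)" and w\<^sub>0: "w\<^sub>0 \<in> J"
  have len: "length w = m" and letters: "set w \<subseteq> {1..d}" if "w \<in> J" for w
    using J that by (auto simp: words_def)
  let ?R = "recursive_trees m"
  let ?t = "\<lambda>(w, p). unnumbered w p"
  \<comment> \<open>Several pairs of a word and a numbering may yield the same unnumbered tree; its
    coefficient collects them all.\<close>
  define coef where "coef \<tau> = (\<Sum>z\<in>{z \<in> J \<times> ?R. ?t z = \<tau>}. c (fst z))" for \<tau>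
  have fin: "finite (J \<times> ?R)" using J finite_recursive_trees by simp
  have "(\<Sum>\<tau>\<in>?t ` (J \<times> ?R). coef \<tau> *\<^sub>R tree_field V \<tau> x) = 0" for x
  proof -
    have "(\<Sum>\<tau>\<in>?t ` (J \<times> ?R). coef \<tau> *\<^sub>R tree_field V \<tau> x)
      = (\<Sum>\<tau>\<in>?t ` (J \<times> ?R). \<Sum>z\<in>{z \<in> J \<times> ?R. ?t z = \<tau>}. c (fst z) *\<^sub>R tree_field V (?t z) x)"
      unfolding coef_def scaleR_sum_left by (intro sum.cong refl) auto
    also have "\<dots> = (\<Sum>z\<in>J \<times> ?R. c (fst z) *\<^sub>R tree_field V (?t z) x)"
      by (rule sum.image_gen[OF fin, symmetric])
    also have "\<dots> = (\<Sum>w\<in>J. c w *\<^sub>R (\<Sum>p\<in>?R. tree_field V (unnumbered w p) x))"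
      by (simp add: sum.cartesian_product scaleR_sum_right case_prod_unfold)
    also have "\<dots> = 0"
    \<comment> \<open>The test function for component \<open>j\<close> is the \<open>j\<close>-th
      coordinate function.\<close>
    proof (rule vec_eq_iff[THEN iffD2], rule allI)
      fix j
      have "(\<Sum>w\<in>J. c w *\<^sub>R (\<Sum>p\<in>?R. tree_field V (unnumbered w p) x)) $ j
        = (\<Sum>w\<in>J. c w *\<^sub>R ((\<Sum>p\<in>?R. tree_field V (unnumbered w p) x) $ j))"
        by (simp only: sum_component vector_scaleR_component)
      also have "\<dots> = (\<Sum>w\<in>J. c w *\<^sub>R word_op V w (\<lambda>x. x $ j) x)"
      proof (intro sum.cong refl arg_cong2[where f = scaleR])
        fix w assume w: "w \<in> J"
        have "w \<noteq> []" using len[OF w] assms(2) by auto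
        moreover have "smooth (V i)" if "i \<in> set w" for i
          using letters[OF w] that by (intro assms(3)) auto
        ultimately show "(\<Sum>p\<in>?R. tree_field V (unnumbered w p) x) $ j = word_op V w (\<lambda>x. x $ j) x"
          using word_op_coordinate[of w V j x] len[OF w] by simp
      qed
      also have "\<dots> = 0" using J smooth_vec_nth by force
      finally show "(\<Sum>w\<in>J. c w *\<^sub>R (\<Sum>p\<in>?R. tree_field V (unnumbered w p) x)) $ j = 0 $ j"
        by simp
    qed
    finally show ?thesis .
  qed
  moreover have "?t ` (J \<times> ?R) \<subseteq> trees d m" using J by (auto simp: trees_def)
  moreover have "finite (?t ` (J \<times> ?R))" using fin by simp
  ultimately have "\<forall>\<tau>\<in>?t ` (J \<times> ?R). coef \<tau> = 0"
    using assms(4) unfolding fields_lin_indep_def lin_indep_family_def by blast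
  moreover have "unnumbered w\<^sub>0 (ladder m) \<in> ?t ` (J \<times> ?R)"
    using w\<^sub>0 ladder_in_recursive_trees by (intro image_eqI[of _ _ "(w\<^sub>0, ladder m)"]) auto
  ultimately have "coef (unnumbered w\<^sub>0 (ladder m)) = 0" by blast
  \<comment> \<open>The ladder arises from one pair only, so its collected coefficient is the single
    number \<open>c w\<^sub>0\<close>.\<close>
  moreover have "{z \<in> J \<times> ?R. ?t z = unnumbered w\<^sub>0 (ladder m)} = {(w\<^sub>0, ladder m)}"
  proof (intro equalityI subsetI)
    fix z assume "z \<in> {z \<in> J \<times> ?R. ?t z = unnumbered w\<^sub>0 (ladder m)}"
    then show "z \<in> {(w\<^sub>0, ladder m)}"
      using unnumbered_eq_ladder[OF len len[OF w\<^sub>0]] by auto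
  qed (use w\<^sub>0 ladder_in_recursive_trees in auto)
  ultimately show "c w\<^sub>0 = 0" by (simp add: coef_def)
qed

end
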